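(* Let $p,k\in\mathbb{N}$ and let $a,b\in\mathbb{C}\setminus\{0,-1,-2,\ldots\}$ with $a\neq b+r$ for every $r\in\{1,2,\ldots,k\}$. Then $$\sum_{n=1}^\infty \frac{H_n}{(n+a)^p\binom{n+k+b}{k}}=\sum_{r=1}^k (-1)^{r+1} r\binom{k}{r}\frac{1}{(a-b-r)^{p-1}}\left\{\frac{1}{b+r-a}\left(\frac{H_a}{a}-\frac{H_{b+r}}{b+r}\right)+\frac{H_{b+r}^2-H_a^2}{2(b+r-a)}+\frac{\zeta(2,a+1)-\zeta(2,b+r+1)}{2(b+r-a)}\right\}$$ $$\qquad-\sum_{r=1}^k(-1)^{r+1}r\binom{k}{r}\sum_{j=2}^p\frac{1}{(a-b-r)^{p+1-j}}\sum_{n=1}^\infty\frac{H_n}{(n+a)^j}.$$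
   Context: $\mathbb{N}=\{1,2,3,\ldots\}$. For $n\in\mathbb{N}$, $H_n=\sum_{j=1}^n \frac1j$. For $\alpha\in\mathbb{C}\setminus\{-1,-2,\ldots\}$ the shifted harmonic number is $H_\alpha=\psi(\alpha+1)+\gamma=\sum_{l=1}^\infty\left(\frac1l-\frac1{l+\alpha}\right)$, where $\psi$ is the digamma function and $\gamma$ the Euler–Mascheroni constant. $\zeta(s,c)=\sum_{n=0}^\infty (n+c)^{-s}$ is the Hurwitz zeta function. The generalized binomial coefficient is $\binom{u}{v}=\frac{\Gamma(u+1)}{\Gamma(v+1)\Gamma(u-v+1)}$; for $k\in\mathbb{N}$, $\binom{u}{k}=\frac{u(u-1)\cdots(u-k+1)}{k!}$. Empty sums are $0$. The series on the left is denoted $W_k^{(a,b)}(1,p)$ in the paper. *)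

theory Defs
  imports "HOL-Analysis.Analysis"
begin

definition shifted_harm :: "complex \<Rightarrow> complex" where
  "shifted_harm \<alpha> = Digamma (\<alpha> + 1) + euler_mascheroni"

lemma shifted_harm_sums:
  assumes "\<alpha> + 1 \<noteq> 0"
  shows "(\<lambda>l. 1 / of_nat (Suc l) - 1 / (of_nat (Suc l) + \<alpha>)) sums shifted_harm \<alpha>"
  using summable_sums[OF summable_Digamma[OF assms]]
  by (simp add: shifted_harm_def Digamma_def inverse_eq_divide add_ac)

lemma shifted_harm_of_nat: "shifted_harm (of_nat n) = harm n"
  using Digamma_of_nat[of n, where ?'a = complex] by (simp add: shifted_harm_def add_ac)

(* The powers are principal ones.  The series is only meaningful for Re s > 1 and c not in
   {0, -1, -2, ...}; elsewhere the value carries no meaning. *)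
definition hurwitz_zeta :: "complex \<Rightarrow> complex \<Rightarrow> complex" where
  "hurwitz_zeta s c = (\<Sum>n. (of_nat n + c) powr (- s))"

lemma hurwitz_zeta_2_sums:
  assumes "c \<notin> \<int>\<^sub>\<le>\<^sub>0"
  shows "(\<lambda>n. 1 / (of_nat n + c) ^ 2) sums hurwitz_zeta 2 c"
proof -
  have nz: "of_nat n + c \<noteq> 0" for n
    using assms by (metis add.commute add_eq_0_iff2 minus_of_nat_in_nonpos_Ints)
  have eq: "(of_nat n + c) powr (- 2) = 1 / (of_nat n + c) ^ 2" for n
    using nz[of n] powr_nat'[of "of_nat n + c" 2] by (simp add: powr_minus inverse_eq_divide)
  have "c \<noteq> 0" using assms by auto
  from Polygamma_converges'[OF this, of 2]
  have "summable (\<lambda>n. 1 / (of_nat n + c) ^ 2)"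
    by (simp add: inverse_eq_divide add_ac)
  then show ?thesis
    by (simp add: hurwitz_zeta_def eq summable_sums)
qed

end

theory Submission
  imports Defs
begin

text \<open>
  Two partial fraction expansions reduce the series to a single one. The reciprocal of the
  binomial coefficient is a combination of the simple fractions \<open>1 / (n + b + r)\<close>
  (\<open>inverse_gbinomial_partial_fraction\<close>), and for \<open>c = b + r \<noteq> a\<close> the term
  \<open>1 / ((n + a)^p (n + c))\<close> splits into pure powers of \<open>1 / (n + a)\<close> and a multiple of
  \<open>1 / ((n + a) (n + c))\<close> (\<open>power_times_linear_partial_fraction\<close>). The pure powers give the
  last sum of the formula; what has to be evaluated is the series of
  \<open>H\<^sub>n / ((n + a) (n + c))\<close>, that is, of \<open>H\<^sub>n (1 / (n + a) - 1 / (n + c))\<close>.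

  Splitting \<open>H\<^sub>n = H\<^sub>n\<^sub>-\<^sub>1 + 1/n\<close> separates off \<open>H\<^sub>a / a - H\<^sub>c / c\<close> and leaves
  \<open>T(a, c) = \<Sum>\<^sub>n H\<^sub>n\<^sub>-\<^sub>1 (1 / (n + a) - 1 / (n + c))\<close>. The claim \<open>harm_diff_sums\<close> is that
  \<open>T(a, c) = K(c) - K(a)\<close> with \<open>K(x) = (H\<^sub>x\<^sup>2 - \<zeta>(2, x + 1)) / 2\<close>. It follows from the behaviour
  of both sides under the simultaneous shift \<open>(a, c) \<mapsto> (a + 1, c + 1)\<close>. Summation by parts
  shows that \<open>T\<close> changes by \<open>H\<^sub>c\<^sub>+\<^sub>1 / (c + 1) - H\<^sub>a\<^sub>+\<^sub>1 / (a + 1)\<close> (\<open>abel_shift_sums\<close>), and the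
  functional equations of \<open>H\<close> and \<open>\<zeta>\<close> give the same change for \<open>K(c) - K(a)\<close>. Hence the
  difference of the two sides is invariant under the shift. It also tends to \<open>0\<close> along
  \<open>(a + N, c + N)\<close>: after such a shift both \<open>T\<close> and the products
  \<open>H\<^sub>N (H\<^sub>c\<^sub>+\<^sub>N - H\<^sub>a\<^sub>+\<^sub>N)\<close>, which control \<open>H\<^sub>c\<^sub>+\<^sub>N\<^sup>2 - H\<^sub>a\<^sub>+\<^sub>N\<^sup>2\<close>, are bounded by a tail of
  the absolutely convergent series of \<open>H\<^sub>n / ((n + a) (n + c))\<close>
  (\<open>weighted_shift_tendsto_0\<close>), while the values of \<open>\<zeta>\<close> are themselves tails. So the difference is \<open>0\<close>.
\<close>

section \<open>Growth of harmonic numbers\<close>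

text \<open>A bound by any power of \<open>n\<close> below the first is enough to make \<open>H\<^sub>n / n\<^sup>2\<close> summable and
  \<open>H\<^sub>n / n\<close> a null sequence; the square root has the simplest induction, since
  \<open>sqrt (n + 1) - sqrt n \<ge> 1 / (2 sqrt (n + 1)) \<ge> 1 / (2 (n + 1))\<close>.\<close>

lemma harm_le_sqrt: "harm n \<le> 2 * sqrt (real n)"
proof (induction n)
  case 0
  then show ?case by (simp add: harm_expand)
next
  case (Suc n)
  define x y where "x = sqrt (real n)" and "y = sqrt (real (Suc n))"
  have xy: "0 \<le> x" "x \<le> y" "0 < y" "y * y = x * x + 1" "1 \<le> y"
    by (simp_all add: x_def y_def)
  have "1 = (y - x) * (y + x)"
    using xy(4) by (simp add: algebra_simps)
  also have "\<dots> \<le> (y - x) * (2 * y)"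
    using xy by (intro mult_left_mono) auto
  also have "\<dots> = (2 * (y - x)) * y"
    by simp
  also have "\<dots> \<le> (2 * (y - x)) * y * y"
    using xy mult_left_mono[of 1 y "2 * (y - x) * y"] by simp
  finally have "1 \<le> 2 * (y - x) * y * y" .
  then have "inverse (y * y) \<le> 2 * (y - x)"
    unfolding inverse_eq_divide using xy(3)
    by (subst pos_divide_le_eq) (simp_all only: mult_pos_pos mult.assoc)
  moreover have "y * y = real (Suc n)"
    by (simp add: y_def)
  ultimately show ?case
    using Suc.IH by (simp add: harm_Suc x_def y_def)
qed

lemma eventually_norm_add_ge_half:
  "eventually (\<lambda>n. real (Suc n) / 2 \<le> norm (of_nat (Suc n) + c :: complex)) sequentially"
proof -
  obtain M :: nat where "2 * norm c \<le> real M"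
    using real_arch_simple by blast
  then have "real (Suc n) / 2 \<le> norm (of_nat (Suc n) + c)" if "n \<ge> M" for n
    using norm_diff_ineq[of "of_nat (Suc n) :: complex" c] that
    by (simp del: of_nat_Suc)
  then show ?thesis
    by (auto simp: eventually_at_top_linorder)
qed

text \<open>By the two preceding bounds the terms are eventually at most \<open>8 n powr (-3/2)\<close>. The norm in
  the denominator makes this the absolute convergence of the series of
  \<open>H\<^sub>n / ((n + a) (n + c))\<close>, whose tails serve as majorants later on.\<close>

lemma summable_harm_over_shifted_pair:
  fixes a c :: complex
  shows "summable (\<lambda>n. harm (Suc n) / norm ((of_nat (Suc n) + a) * (of_nat (Suc n) + c)))"
proof (rule summable_comparison_test_ev)
  show "summable (\<lambda>n. 8 * real (Suc n) powr (-3/2))"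
    by (intro summable_mult iffD2[OF summable_Suc_iff[of "\<lambda>n. real n powr (-3/2)"]])
      (simp add: summable_real_powr_iff)
  show "eventually (\<lambda>n. norm (harm (Suc n) /
      norm ((of_nat (Suc n) + a) * (of_nat (Suc n) + c))) \<le> 8 * real (Suc n) powr (-3/2)) sequentially"
    using eventually_norm_add_ge_half[of a] eventually_norm_add_ge_half[of c]
  proof eventually_elim
    case (elim n)
    let ?x = "real (Suc n)"
    have x: "?x > 0" by simp
    have "harm (Suc n) / norm ((of_nat (Suc n) + a) * (of_nat (Suc n) + c))
        \<le> 2 * sqrt ?x / (?x / 2 * (?x / 2))"
      unfolding norm_mult using elim x
      by (intro frac_le mult_mono harm_le_sqrt mult_pos_pos harm_nonneg) auto
    also have "\<dots> = 8 * (?x powr (1/2) / ?x powr 2)"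
      using x by (simp add: powr_half_sqrt power2_eq_square del: of_nat_Suc)
    also have "\<dots> = 8 * ?x powr (-3/2)"
      by (subst powr_diff [symmetric]) (simp del: of_nat_Suc)
    finally show ?case
      by (simp add: harm_nonneg del: of_nat_Suc)
  qed
qed

lemma summable_harm_over_shifted_power:
  fixes a :: complex
  assumes "j \<ge> 2"
  shows "summable (\<lambda>n. harm (Suc n) / (of_nat (Suc n) + a) ^ j)"
proof (rule summable_comparison_test_ev[OF _ summable_harm_over_shifted_pair[of a a]])
  have "eventually (\<lambda>n. real (Suc n) \<ge> 2) sequentially"
    by (auto simp: eventually_at_top_linorder intro!: exI[of _ 1])
  then show "eventually (\<lambda>n. norm (harm (Suc n) / (of_nat (Suc n) + a) ^ j) \<le>
      harm (Suc n) / norm ((of_nat (Suc n) + a) * (of_nat (Suc n) + a))) sequentially"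
    using eventually_norm_add_ge_half[of a]
  proof eventually_elim
    case (elim n)
    let ?y = "norm (of_nat (Suc n) + a)"
    have "1 \<le> real (Suc n) / 2" using elim(1) by simp
    then have "1 \<le> ?y" using elim(2) by (rule order.trans)
    then have "?y * ?y \<le> ?y ^ j"
      using power_increasing[OF assms, of ?y] by (simp add: power2_eq_square)
    moreover have "0 < ?y"
      using \<open>1 \<le> ?y\<close> by (rule less_le_trans[OF zero_less_one])
    ultimately show ?case
      unfolding norm_divide norm_power norm_harm norm_mult
      by (intro divide_left_mono harm_nonneg mult_pos_pos zero_less_power)
  qed
qed

lemma harm_over_shifted_tendsto_0:
  fixes a :: complex
  shows "(\<lambda>n. harm (Suc n) / (of_nat (Suc n) + a)) \<longlonglongrightarrow> 0"
proof (rule Lim_null_comparison)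
  show "(\<lambda>n. 4 * real (Suc n) powr (-1/2)) \<longlonglongrightarrow> 0"
    by (intro tendsto_mult_right_zero tendsto_neg_powr
        filterlim_compose[OF filterlim_real_sequentially filterlim_Suc]) simp
  show "eventually (\<lambda>n. norm (harm (Suc n) / (of_nat (Suc n) + a)) \<le> 4 * real (Suc n) powr (-1/2))
      sequentially"
    using eventually_norm_add_ge_half[of a]
  proof eventually_elim
    case (elim n)
    let ?x = "real (Suc n)"
    have x: "?x > 0" by simp
    have "norm (harm (Suc n) / (of_nat (Suc n) + a)) \<le> 2 * sqrt ?x / (?x / 2)"
      unfolding norm_divide norm_harm using elim x
      by (intro frac_le harm_le_sqrt harm_nonneg) auto
    also have "\<dots> = 4 * (?x powr (1/2) / ?x powr 1)"
      using x by (simp add: powr_half_sqrt del: of_nat_Suc)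
    also have "\<dots> = 4 * ?x powr (-1/2)"
      by (subst powr_diff [symmetric]) (simp del: of_nat_Suc)
    finally show ?case .
  qed
qed

section \<open>Shifted harmonic numbers and the Hurwitz zeta function\<close>

lemma of_nat_Suc_add_neq_0:
  fixes a :: complex
  assumes "a + 1 \<notin> \<int>\<^sub>\<le>\<^sub>0"
  shows "of_nat (Suc n) + a \<noteq> 0"
  using assms plus_of_nat_eq_0_imp[of "a + 1" n] by (auto simp: add_ac)

lemma add_of_nat_notin_nonpos_Ints:
  fixes a :: complex
  assumes "a \<notin> \<int>\<^sub>\<le>\<^sub>0"
  shows "a + of_nat n \<notin> \<int>\<^sub>\<le>\<^sub>0"
  using assms nonpos_Ints_diff_Nats[of "a + of_nat n" "of_nat n"] by auto

lemma shifted_harm_diff_sums: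
  assumes "a + 1 \<noteq> 0" "c + 1 \<noteq> 0"
  shows "(\<lambda>n. 1 / (of_nat (Suc n) + a) - 1 / (of_nat (Suc n) + c)) sums
    (shifted_harm c - shifted_harm a)"
  using sums_diff[OF shifted_harm_sums[OF assms(2)] shifted_harm_sums[OF assms(1)]]
  by simp

lemma shifted_harm_plus1:
  assumes "a + 1 \<noteq> 0"
  shows "shifted_harm (a + 1) = shifted_harm a + 1 / (a + 1)"
  using Digamma_plus1[OF assms] by (simp add: shifted_harm_def)

lemma shifted_harm_over_self_sums:
  assumes "a \<noteq> 0" "a + 1 \<notin> \<int>\<^sub>\<le>\<^sub>0"
  shows "(\<lambda>n. 1 / (of_nat (Suc n) * (of_nat (Suc n) + a))) sums (shifted_harm a / a)"
proof -
  have "a + 1 \<noteq> 0" using assms(2) by auto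
  from sums_divide[OF shifted_harm_sums[OF this], of a] show ?thesis
  proof (rule back_subst[where P = "\<lambda>f. f sums _"], intro ext)
    fix n
    have "of_nat (Suc n) + a \<noteq> 0" "of_nat (Suc n) \<noteq> (0::complex)"
      using of_nat_Suc_add_neq_0[OF assms(2)] by (auto simp del: of_nat_Suc)
    then show "(1 / of_nat (Suc n) - 1 / (of_nat (Suc n) + a)) / a =
        1 / (of_nat (Suc n) * (of_nat (Suc n) + a))"
      using assms(1) by (simp add: divide_simps del: of_nat_Suc)
  qed
qed

lemma hurwitz_zeta_2_plus1:
  assumes "c \<notin> \<int>\<^sub>\<le>\<^sub>0"
  shows "hurwitz_zeta 2 (c + 1) = hurwitz_zeta 2 c - 1 / c ^ 2"
proof -
  have "c + 1 \<notin> \<int>\<^sub>\<le>\<^sub>0"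
    using add_of_nat_notin_nonpos_Ints[OF assms, of 1] by simp
  from hurwitz_zeta_2_sums[OF this]
  have "(\<lambda>n. 1 / (of_nat (Suc n) + c) ^ 2) sums hurwitz_zeta 2 (c + 1)"
    by (simp add: add_ac)
  from sums_Suc[OF this] have "(\<lambda>n. 1 / (of_nat n + c) ^ 2) sums (hurwitz_zeta 2 (c + 1) + 1 / c ^ 2)"
    by simp
  with hurwitz_zeta_2_sums[OF assms] show ?thesis
    using sums_unique2 by (simp add: eq_diff_eq)
qed

lemma suminf_tail_tendsto_0:
  fixes f :: "nat \<Rightarrow> 'a :: real_normed_vector"
  assumes "summable f"
  shows "(\<lambda>N. \<Sum>n. f (n + N)) \<longlonglongrightarrow> 0"
proof -
  have "(\<lambda>N. suminf f - (\<Sum>n<N. f n)) \<longlonglongrightarrow> suminf f - suminf f"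
    by (intro tendsto_intros summable_LIMSEQ assms)
  then show ?thesis
    by (simp add: suminf_minus_initial_segment[OF assms])
qed

lemma hurwitz_zeta_2_shift_tendsto_0:
  assumes "c \<notin> \<int>\<^sub>\<le>\<^sub>0"
  shows "(\<lambda>N. hurwitz_zeta 2 (c + of_nat N)) \<longlonglongrightarrow> 0"
proof -
  have "hurwitz_zeta 2 (c + of_nat N) = (\<Sum>n. 1 / (of_nat (n + N) + c) ^ 2)" for N
    using sums_unique[OF hurwitz_zeta_2_sums[OF add_of_nat_notin_nonpos_Ints[OF assms, of N]]]
    by (simp add: add_ac)
  with suminf_tail_tendsto_0[OF sums_summable[OF hurwitz_zeta_2_sums[OF assms]]]
  show ?thesis by simp
qed

section \<open>Vanishing under large simultaneous shifts\<close>

lemma inverse_diff_eq: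
  fixes x a c :: "'a :: field"
  assumes "x + a \<noteq> 0" "x + c \<noteq> 0"
  shows "1 / (x + a) - 1 / (x + c) = (c - a) / ((x + a) * (x + c))"
  using assms by (simp add: divide_simps)

text \<open>The \<open>n\<close>-th term after a shift by \<open>N\<close> has the denominators of the term of index \<open>n + N\<close> before
  the shift. As long as the weight is also at most \<open>H\<close> at that index, the whole series is
  dominated by the tail from \<open>N\<close> of one fixed convergent series. Weights depending on \<open>n\<close> serve
  the series to be evaluated; weights depending on \<open>N\<close> serve the differences
  \<open>H\<^sub>c\<^sub>+\<^sub>N - H\<^sub>a\<^sub>+\<^sub>N\<close>.\<close>

lemma weighted_shift_tendsto_0:
  fixes a c :: complex and h :: "nat \<Rightarrow> nat \<Rightarrow> real"
  assumes a: "a + 1 \<notin> \<int>\<^sub>\<le>\<^sub>0" and c: "c + 1 \<notin> \<int>\<^sub>\<le>\<^sub>0"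
    and h: "\<And>N n. \<bar>h N n\<bar> \<le> harm (Suc (n + N))"
  shows "(\<lambda>N. \<Sum>n. of_real (h N n) *
      (1 / (of_nat (Suc n) + (a + of_nat N)) - 1 / (of_nat (Suc n) + (c + of_nat N)))) \<longlonglongrightarrow> 0"
proof -
  define w where "w n = norm (c - a) *
    (harm (Suc n) / norm ((of_nat (Suc n) + a) * (of_nat (Suc n) + c)))" for n
  have w: "summable w"
    unfolding w_def by (intro summable_mult summable_harm_over_shifted_pair)
  have "norm (of_real (h N n) *
      (1 / (of_nat (Suc n) + (a + of_nat N)) - 1 / (of_nat (Suc n) + (c + of_nat N)))) \<le> w (n + N)"
    for N n
  proof -
    have eq: "of_nat (Suc n) + (x + of_nat N) = of_nat (Suc (n + N)) + x" for x :: complex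
      by simp
    have "norm (of_real (h N n) * (1 / (of_nat (Suc (n + N)) + a) - 1 / (of_nat (Suc (n + N)) + c)))
      = \<bar>h N n\<bar> * (norm (c - a) / norm ((of_nat (Suc (n + N)) + a) * (of_nat (Suc (n + N)) + c)))"
      by (subst inverse_diff_eq[OF of_nat_Suc_add_neq_0[OF a] of_nat_Suc_add_neq_0[OF c]])
        (simp only: norm_mult norm_divide norm_of_real)
    also have "\<dots> \<le> harm (Suc (n + N)) *
        (norm (c - a) / norm ((of_nat (Suc (n + N)) + a) * (of_nat (Suc (n + N)) + c)))"
      by (intro mult_right_mono h) simp
    also have "\<dots> = w (n + N)"
      unfolding w_def by simp
    finally show ?thesis
      unfolding eq .
  qed
  then have "norm (\<Sum>n. of_real (h N n) *
      (1 / (of_nat (Suc n) + (a + of_nat N)) - 1 / (of_nat (Suc n) + (c + of_nat N))))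
      \<le> (\<Sum>n. w (n + N))" for N
    by (intro norm_suminf_le summable_ignore_initial_segment w)
  then show ?thesis
    by (intro Lim_null_comparison[OF _ suminf_tail_tendsto_0[OF w]]) simp
qed

lemma shifted_harm_diff_weighted_tendsto_0:
  fixes h :: "nat \<Rightarrow> real"
  assumes a: "a + 1 \<notin> \<int>\<^sub>\<le>\<^sub>0" and c: "c + 1 \<notin> \<int>\<^sub>\<le>\<^sub>0"
    and h: "\<And>N. \<bar>h N\<bar> \<le> harm (Suc N)"
  shows "(\<lambda>N. of_real (h N) * (shifted_harm (c + of_nat N) - shifted_harm (a + of_nat N))) \<longlonglongrightarrow> 0"
proof -
  have nz: "x + of_nat N + 1 \<noteq> 0" if "x + 1 \<notin> \<int>\<^sub>\<le>\<^sub>0" for x :: complex and N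
    using of_nat_Suc_add_neq_0[OF that, of N] by (simp add: add_ac)
  have "of_real (h N) * (shifted_harm (c + of_nat N) - shifted_harm (a + of_nat N)) =
     (\<Sum>n. of_real (h N) *
      (1 / (of_nat (Suc n) + (a + of_nat N)) - 1 / (of_nat (Suc n) + (c + of_nat N))))" for N
    by (intro sums_unique sums_mult shifted_harm_diff_sums nz a c)
  moreover have "\<bar>h N\<bar> \<le> harm (Suc (n + N))" for n N
    using h[of N] harm_mono[of "Suc N" "Suc (n + N)", where ?'a = real] by simp
  ultimately show ?thesis
    using weighted_shift_tendsto_0[OF a c, of "\<lambda>N n. h N"] by simp
qed

text \<open>The factor \<open>H\<^sub>c\<^sub>+\<^sub>N + H\<^sub>a\<^sub>+\<^sub>N\<close> of the factored difference of squares is unbounded, but it is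
  \<open>2 H\<^sub>N\<close> up to a null sequence, and \<open>H\<^sub>N (H\<^sub>c\<^sub>+\<^sub>N - H\<^sub>a\<^sub>+\<^sub>N)\<close> still tends to \<open>0\<close>.\<close>

lemma shifted_harm_square_diff_tendsto_0:
  assumes a: "a + 1 \<notin> \<int>\<^sub>\<le>\<^sub>0" and c: "c + 1 \<notin> \<int>\<^sub>\<le>\<^sub>0"
  shows "(\<lambda>N. shifted_harm (c + of_nat N) ^ 2 - shifted_harm (a + of_nat N) ^ 2) \<longlonglongrightarrow> 0"
proof -
  have one: "1 \<le> (harm (Suc N) :: real)" for N
    using harm_mono[of 1 "Suc N", where ?'a = real] by (simp add: harm_expand)
  have lim1: "(\<lambda>N. shifted_harm (y + of_nat N) - shifted_harm (x + of_nat N)) \<longlonglongrightarrow> 0"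
    if "x + 1 \<notin> \<int>\<^sub>\<le>\<^sub>0" "y + 1 \<notin> \<int>\<^sub>\<le>\<^sub>0" for x y
    using shifted_harm_diff_weighted_tendsto_0[OF that, of "\<lambda>_. 1"] one by simp
  \<comment> \<open>With \<open>D\<close> for \<open>H\<^sub>c\<^sub>+\<^sub>N - H\<^sub>a\<^sub>+\<^sub>N\<close>, the sum \<open>H\<^sub>c\<^sub>+\<^sub>N + H\<^sub>a\<^sub>+\<^sub>N\<close> is compared with \<open>2 H\<^sub>N\<close>, which is
    the value of \<open>shifted_harm\<close> at \<open>0 + N\<close>.\<close>
  define D where "D N = shifted_harm (c + of_nat N) - shifted_harm (a + of_nat N)" for N
  have D: "D \<longlonglongrightarrow> 0"
    unfolding D_def by (rule lim1[OF a c])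
  have HD: "(\<lambda>N. harm N * D N) \<longlonglongrightarrow> 0"
    using shifted_harm_diff_weighted_tendsto_0[OF a c, of harm]
    by (simp add: D_def of_real_harm harm_mono)
  have zero: "(0::complex) + 1 \<notin> \<int>\<^sub>\<le>\<^sub>0"
    by simp
  have "(\<lambda>N. D N * (shifted_harm (c + of_nat N) - shifted_harm (0 + of_nat N)) +
      D N * (shifted_harm (a + of_nat N) - shifted_harm (0 + of_nat N)) + 2 * (harm N * D N))
      \<longlonglongrightarrow> 0 * 0 + 0 * 0 + 2 * 0"
    by (intro tendsto_intros D HD lim1 a c zero)
  then show ?thesis
    by (simp add: D_def shifted_harm_of_nat algebra_simps power2_eq_square)
qed

section \<open>Evaluation of the series with two linear factors\<close>

text \<open>Summation by parts: the bracket is, up to sign, the forward difference of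
  \<open>1 / (n + 1 + a)\<close>, so the
  differences \<open>1 / n\<close> of the harmonic numbers take the place of \<open>H\<^sub>n\<close>, and the boundary term
  vanishes in the limit.\<close>

lemma abel_shift_sums:
  assumes a: "a + 1 \<notin> \<int>\<^sub>\<le>\<^sub>0"
  shows "(\<lambda>n. harm n * (1 / (of_nat (Suc n) + a) - 1 / (of_nat (Suc n) + (a + 1)))) sums
    (shifted_harm (a + 1) / (a + 1))"
proof -
  have a2: "a + 1 + 1 \<notin> \<int>\<^sub>\<le>\<^sub>0"
    using add_of_nat_notin_nonpos_Ints[OF a, of 1] by simp
  have a1: "a + 1 \<noteq> 0"
    using a by auto
  define s where "s n = (1 / (of_nat (Suc n) * (of_nat (Suc n) + (a + 1))) :: complex)" for n
  have partial: "(\<Sum>n<Suc m. harm n * (1 / (of_nat (Suc n) + a) - 1 / (of_nat (Suc n) + (a + 1)))) =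
      (\<Sum>n<m. s n) - harm m / (of_nat (Suc m) + (a + 1))" for m
  proof (induction m)
    case 0
    then show ?case by (simp add: harm_expand)
  next
    case (Suc m)
    define X where "X = 1 / (of_nat (Suc m) + (a + 1))"
    define Y where "Y = 1 / (of_nat (Suc (Suc m)) + (a + 1))"
    have "1 / (of_nat (Suc (Suc m)) + a) = X"
      by (simp add: X_def add_ac)
    moreover have "s m = (harm (Suc m) - harm m) * X"
      by (simp add: s_def X_def harm_Suc inverse_eq_divide del: of_nat_Suc)
    moreover have "harm m / (of_nat (Suc m) + (a + 1)) = harm m * X"
      "harm (Suc m) / (of_nat (Suc (Suc m)) + (a + 1)) = harm (Suc m) * Y"
      by (simp_all add: X_def Y_def del: of_nat_Suc)
    ultimately show ?case
      unfolding sum.lessThan_Suc[of _ "Suc m"] sum.lessThan_Suc[of s m] Suc.IH Y_def [symmetric]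
      by (simp only:) (simp add: algebra_simps)
  qed
  have "(\<lambda>m. harm (Suc m) / (of_nat (Suc m) + (a + 2))) \<longlonglongrightarrow> 0"
    by (rule harm_over_shifted_tendsto_0)
  then have "(\<lambda>m. harm (Suc m) / (of_nat (Suc (Suc m)) + (a + 1))) \<longlonglongrightarrow> 0"
    by (simp add: add_ac)
  then have "(\<lambda>m. harm m / (of_nat (Suc m) + (a + 1))) \<longlonglongrightarrow> 0"
    by (rule LIMSEQ_imp_Suc)
  moreover have "(\<lambda>m. \<Sum>n<m. s n) \<longlonglongrightarrow> shifted_harm (a + 1) / (a + 1)"
    using shifted_harm_over_self_sums[OF a1 a2] by (simp add: s_def sums_def)
  ultimately have "(\<lambda>m. (\<Sum>n<m. s n) - harm m / (of_nat (Suc m) + (a + 1)))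
      \<longlonglongrightarrow> shifted_harm (a + 1) / (a + 1) - 0"
    by (intro tendsto_diff)
  then show ?thesis
    unfolding sums_def by (subst filterlim_sequentially_Suc [symmetric]) (simp only: partial diff_0_right)
qed

text \<open>The error \<open>E\<close> of the claimed evaluation is invariant under shifting both parameters by \<open>1\<close> and
  tends to \<open>0\<close> under large shifts, so it is \<open>0\<close>. Since \<open>harm n\<close> goes with the index \<open>n + 1\<close>
  here, no terms \<open>H\<^sub>a / a\<close> and \<open>H\<^sub>c / c\<close> appear in the value.\<close>

lemma harm_diff_sums:
  assumes a: "a + 1 \<notin> \<int>\<^sub>\<le>\<^sub>0" and c: "c + 1 \<notin> \<int>\<^sub>\<le>\<^sub>0"
  shows "(\<lambda>n. harm n * (1 / (of_nat (Suc n) + a) - 1 / (of_nat (Suc n) + c))) sums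
    ((shifted_harm c ^ 2 - hurwitz_zeta 2 (c + 1)) / 2 -
     (shifted_harm a ^ 2 - hurwitz_zeta 2 (a + 1)) / 2)"
proof -
  define t where "t x y n = (harm n * (1 / (of_nat (Suc n) + x) - 1 / (of_nat (Suc n) + y)) :: complex)"
    for x y n
  define K where "K x = (shifted_harm x ^ 2 - hurwitz_zeta 2 (x + 1)) / 2" for x
  define E where "E x y = suminf (t x y) - (K y - K x)" for x y
  have summ: "summable (t x y)" if x: "x + 1 \<notin> \<int>\<^sub>\<le>\<^sub>0" and y: "y + 1 \<notin> \<int>\<^sub>\<le>\<^sub>0" for x y
  proof (rule summable_comparison_test')
    show "summable (\<lambda>n. norm (y - x) *
        (harm (Suc n) / norm ((of_nat (Suc n) + x) * (of_nat (Suc n) + y))))"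
      by (intro summable_mult summable_harm_over_shifted_pair)
    show "norm (t x y n) \<le> norm (y - x) *
        (harm (Suc n) / norm ((of_nat (Suc n) + x) * (of_nat (Suc n) + y)))" for n
    proof -
      let ?q = "norm (y - x) / norm ((of_nat (Suc n) + x) * (of_nat (Suc n) + y))"
      have "norm (t x y n) = harm n * ?q"
        unfolding t_def inverse_diff_eq[OF of_nat_Suc_add_neq_0[OF x] of_nat_Suc_add_neq_0[OF y]]
        by (simp only: norm_mult norm_divide norm_harm)
      also have "\<dots> \<le> harm (Suc n) * ?q"
        by (intro mult_right_mono harm_mono) auto
      finally show ?thesis by (simp only: mult.commute times_divide_eq_left times_divide_eq_right)
    qed
  qed
  have step: "E (x + 1) (y + 1) = E x y" if x: "x + 1 \<notin> \<int>\<^sub>\<le>\<^sub>0" and y: "y + 1 \<notin> \<int>\<^sub>\<le>\<^sub>0" for x y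
  proof -
    have K: "K (z + 1) = K z + shifted_harm (z + 1) / (z + 1)" if z: "z + 1 \<notin> \<int>\<^sub>\<le>\<^sub>0" for z
    proof -
      have "z + 1 \<noteq> 0" using z by auto
      then show ?thesis
        unfolding K_def shifted_harm_plus1[OF \<open>z + 1 \<noteq> 0\<close>] hurwitz_zeta_2_plus1[OF z]
        by (simp add: divide_simps) (simp add: algebra_simps power2_eq_square)
    qed
    have "t (x + 1) (y + 1) n = t x y n -
        harm n * (1 / (of_nat (Suc n) + x) - 1 / (of_nat (Suc n) + (x + 1))) +
        harm n * (1 / (of_nat (Suc n) + y) - 1 / (of_nat (Suc n) + (y + 1)))" for n
      by (simp add: t_def ring_distribs)
    then have "t (x + 1) (y + 1) sums
        (suminf (t x y) - shifted_harm (x + 1) / (x + 1) + shifted_harm (y + 1) / (y + 1))"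
      using sums_add[OF sums_diff[OF summable_sums[OF summ[OF x y]] abel_shift_sums[OF x]]
          abel_shift_sums[OF y]] by presburger
    from sums_unique[OF this, symmetric] show ?thesis
      by (simp add: E_def K x y)
  qed
  have shift: "x + of_nat N + 1 \<notin> \<int>\<^sub>\<le>\<^sub>0" if "x + 1 \<notin> \<int>\<^sub>\<le>\<^sub>0" for x :: complex and N
    using add_of_nat_notin_nonpos_Ints[OF that, of N] by (simp add: add_ac)
  have const: "E (a + of_nat N) (c + of_nat N) = E a c" for N
  proof (induction N)
    case (Suc N)
    then show ?case
      using step[OF shift[OF a] shift[OF c], of N N] by (simp add: add_ac)
  qed simp
  have "(\<lambda>N. E (a + of_nat N) (c + of_nat N)) \<longlonglongrightarrow> 0"
  proof -
    have "(\<lambda>N. suminf (t (a + of_nat N) (c + of_nat N))) \<longlonglongrightarrow> 0"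
      using weighted_shift_tendsto_0[OF a c, of "\<lambda>N n. harm n"]
      unfolding t_def by (simp add: of_real_harm harm_mono)
    moreover have zeta: "(\<lambda>N. hurwitz_zeta 2 (x + of_nat N + 1)) \<longlonglongrightarrow> 0" if "x + 1 \<notin> \<int>\<^sub>\<le>\<^sub>0" for x
      using hurwitz_zeta_2_shift_tendsto_0[OF that] by (simp add: add_ac)
    ultimately have "(\<lambda>N. suminf (t (a + of_nat N) (c + of_nat N)) -
       ((shifted_harm (c + of_nat N) ^ 2 - shifted_harm (a + of_nat N) ^ 2) / 2
        - (hurwitz_zeta 2 (c + of_nat N + 1) - hurwitz_zeta 2 (a + of_nat N + 1)) / 2))
       \<longlonglongrightarrow> 0 - (0 / 2 - (0 - 0) / 2)"
      by (intro tendsto_intros shifted_harm_square_diff_tendsto_0 zeta a c) auto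
    then show ?thesis
      by (simp add: E_def K_def diff_divide_distrib algebra_simps)
  qed
  then have "E a c = 0"
    by (simp add: const LIMSEQ_const_iff)
  then have "suminf (t a c) = K c - K a"
    by (simp add: E_def)
  with summable_sums[OF summ[OF a c]] show ?thesis
    unfolding K_def t_def by simp
qed

lemma harm_product_sums:
  assumes a: "a \<notin> \<int>\<^sub>\<le>\<^sub>0" and c: "c \<notin> \<int>\<^sub>\<le>\<^sub>0" and ne: "a \<noteq> c"
  shows "(\<lambda>n. harm (Suc n) / ((of_nat (Suc n) + a) * (of_nat (Suc n) + c))) sums
    (1 / (c - a) * (shifted_harm a / a - shifted_harm c / c)
      + (shifted_harm c ^ 2 - shifted_harm a ^ 2) / (2 * (c - a))
      + (hurwitz_zeta 2 (a + 1) - hurwitz_zeta 2 (c + 1)) / (2 * (c - a)))"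
proof -
  have a1: "a + 1 \<notin> \<int>\<^sub>\<le>\<^sub>0" and c1: "c + 1 \<notin> \<int>\<^sub>\<le>\<^sub>0"
    using add_of_nat_notin_nonpos_Ints[of _ 1] a c by auto
  have nz: "a \<noteq> 0" "c \<noteq> 0" "c - a \<noteq> 0" using a c ne by auto
  have eq: "(harm n * (1 / (of_nat (Suc n) + a) - 1 / (of_nat (Suc n) + c)) +
      (1 / (of_nat (Suc n) * (of_nat (Suc n) + a)) - 1 / (of_nat (Suc n) * (of_nat (Suc n) + c))))
      / (c - a) = harm (Suc n) / ((of_nat (Suc n) + a) * (of_nat (Suc n) + c))" for n
  proof -
    have "harm n * (1 / (of_nat (Suc n) + a) - 1 / (of_nat (Suc n) + c)) +
      (1 / (of_nat (Suc n) * (of_nat (Suc n) + a)) - 1 / (of_nat (Suc n) * (of_nat (Suc n) + c)))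
      = harm (Suc n) * (1 / (of_nat (Suc n) + a) - 1 / (of_nat (Suc n) + c))"
      by (simp add: harm_Suc add_divide_distrib right_diff_distrib inverse_eq_divide del: of_nat_Suc)
    then show ?thesis
      unfolding inverse_diff_eq[OF of_nat_Suc_add_neq_0[OF a1] of_nat_Suc_add_neq_0[OF c1]]
      using nz(3) by simp
  qed
  have split: "((x - y) / 2 - (z - w) / 2 + (A - B)) / d =
      1 / d * (A - B) + (x - z) / (2 * d) + (w - y) / (2 * d)" for x y z w A B d :: complex
    by (cases "d = 0") (simp_all add: field_simps)
  show ?thesis
    using sums_divide[OF sums_add[OF harm_diff_sums[OF a1 c1]
        sums_diff[OF shifted_harm_over_self_sums[OF nz(1) a1] shifted_harm_over_self_sums[OF nz(2) c1]]],
        of "c - a"]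
    unfolding eq split .
qed

section \<open>Partial fractions\<close>

text \<open>Pascal's rule makes the left side satisfy \<open>A\<^sub>m\<^sub>+\<^sub>1(x) = A\<^sub>m(x) - A\<^sub>m(x + 1)\<close>: it is the
  \<open>m\<close>-th finite difference of \<open>1 / x\<close>, up to sign. The right side obeys the same recurrence.\<close>

lemma alternating_binomial_partial_fraction:
  fixes x :: "'a :: field_char_0"
  assumes "\<And>i. i \<le> m \<Longrightarrow> x + of_nat i \<noteq> 0"
  shows "(\<Sum>s\<le>m. (-1) ^ s * of_nat (m choose s) / (x + of_nat s)) = fact m / pochhammer x (Suc m)"
  using assms
proof (induction m arbitrary: x)
  case 0
  then show ?case by simp
next
  case (Suc m)
  let ?A = "\<lambda>m x. \<Sum>s\<le>m. (-1) ^ s * of_nat (m choose s) / (x + of_nat s) :: 'a"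
  have "?A (Suc m) x = 1 / x +
      (\<Sum>s\<le>m. (-1) ^ Suc s * of_nat (Suc m choose Suc s) / (x + of_nat (Suc s)))"
    by (subst sum.atMost_Suc_shift) simp
  also have "\<dots> = (1 / x + (\<Sum>s\<le>m. (-1) ^ Suc s * of_nat (m choose Suc s) / (x + of_nat (Suc s))))
      - ?A m (x + 1)"
    by (simp add: sum_subtractf sum_negf add_divide_distrib diff_divide_distrib algebra_simps)
  also have "1 / x + (\<Sum>s\<le>m. (-1) ^ Suc s * of_nat (m choose Suc s) / (x + of_nat (Suc s)))
      = (\<Sum>s\<le>Suc m. (-1) ^ s * of_nat (m choose s) / (x + of_nat s))"
    by (subst sum.atMost_Suc_shift) simp
  also have "\<dots> = ?A m x"
    by simp
  finally have "?A (Suc m) x = ?A m x - ?A m (x + 1)" .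
  also have "\<dots> = fact m / pochhammer x (Suc m) - fact m / pochhammer (x + 1) (Suc m)"
  proof -
    have "x + of_nat i \<noteq> 0" "x + 1 + of_nat i \<noteq> 0" if "i \<le> m" for i
      using Suc.prems[of i] Suc.prems[of "Suc i"] that by (simp_all add: add_ac)
    then show ?thesis
      by (intro arg_cong2[of _ _ _ _ "(-)"] Suc.IH)
  qed
  also have "\<dots> = fact (Suc m) / pochhammer x (Suc (Suc m))"
  proof -
    let ?P = "pochhammer (x + 1) m"
    have nz: "x \<noteq> 0" "x + 1 + of_nat m \<noteq> 0" "?P \<noteq> 0"
      using Suc.prems[of 0] Suc.prems[of "Suc m"] Suc.prems[of "Suc _"]
      by (auto simp: pochhammer_eq_0_iff eq_neg_iff_add_eq_0 add_ac)
    have "pochhammer x (Suc m) = x * ?P" "pochhammer (x + 1) (Suc m) = ?P * (x + 1 + of_nat m)"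
      "pochhammer x (Suc (Suc m)) = x * (?P * (x + 1 + of_nat m))"
      by (simp_all only: pochhammer_rec[of x] pochhammer_Suc[of "x + 1"])
    then show ?thesis
      using nz by (simp add: divide_simps) (simp add: algebra_simps)
  qed
  finally show ?case .
qed

text \<open>The absorption identity \<open>r (k choose r) = k (k - 1 choose r - 1)\<close> turns the weights into the
  alternating binomial coefficients of the preceding lemma, taken at \<open>x + 1\<close>.\<close>

lemma inverse_gbinomial_partial_fraction:
  fixes x :: "'a :: field_char_0"
  assumes "k \<ge> 1" and "\<And>r. r \<in> {1..k} \<Longrightarrow> x + of_nat r \<noteq> 0"
  shows "1 / ((x + of_nat k) gchoose k) =
    (\<Sum>r=1..k. (-1) ^ (r + 1) * of_nat r * of_nat (k choose r) / (x + of_nat r))"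
proof -
  obtain m where k: "k = Suc m" using assms(1) by (cases k) auto
  have "(\<Sum>r=1..k. (-1) ^ (r + 1) * of_nat r * of_nat (k choose r) / (x + of_nat r)) =
      (\<Sum>s\<le>m. of_nat k * ((-1) ^ s * of_nat (m choose s) / (x + 1 + of_nat s)))"
  proof (rule sum.reindex_bij_witness[of _ Suc "\<lambda>r. r - 1"])
    fix r assume "r \<in> {1..k}"
    then obtain s where r: "r = Suc s" by (cases r) auto
    have "of_nat (Suc s) * of_nat (k choose Suc s) = (of_nat k * of_nat (m choose s) :: 'a)"
      unfolding k of_nat_mult [symmetric] by (simp only: Suc_times_binomial_eq mult.commute)
    then show "of_nat k * ((-1) ^ (r - 1) * of_nat (m choose (r - 1)) / (x + 1 + of_nat (r - 1))) =
      (-1) ^ (r + 1) * of_nat r * of_nat (k choose r) / (x + of_nat r)"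
      unfolding r by (simp add: mult_ac add_ac)
  qed (auto simp: k)
  also have "\<dots> = of_nat k * (fact m / pochhammer (x + 1) k)"
    unfolding sum_distrib_left [symmetric] k
    using assms(2)[of "Suc _"] k
    by (subst alternating_binomial_partial_fraction) (auto simp: add_ac)
  also have "\<dots> = 1 / ((x + of_nat k) gchoose k)"
    by (simp add: gbinomial_pochhammer' k)
  finally show ?thesis ..
qed

text \<open>Each step uses \<open>1 / (y z) = (1 / z - 1 / y) / d\<close> to remove one factor \<open>y\<close> next to \<open>z\<close>, at the
  price of a pure power of \<open>1 / y\<close>.\<close>

lemma power_times_linear_partial_fraction:
  fixes y z d :: "'a :: field"
  assumes "y \<noteq> 0" "z \<noteq> 0" "y - z = d" "d \<noteq> 0" "p \<ge> 1"
  shows "1 / (y ^ p * z) = 1 / d ^ (p - 1) * (1 / (y * z)) -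
    (\<Sum>j=2..p. 1 / d ^ (p + 1 - j) * (1 / y ^ j))"
  using assms(5)
proof (induction p rule: dec_induct)
  case base
  then show ?case by simp
next
  case (step p)
  have "1 / (y ^ Suc p * z) = 1 / d * (1 / (y ^ p * z) - 1 / y ^ Suc p)"
  proof -
    have "1 / (q * z) - 1 / (y * q) = d / (y * q * z)" if "q \<noteq> 0" for q
      using assms(1-3) that by (simp add: divide_simps)
    then show ?thesis
      using assms(1,4) by simp
  qed
  also have "\<dots> = 1 / d * (1 / d ^ (p - 1) * (1 / (y * z))) -
     (\<Sum>j=2..p. 1 / d * (1 / d ^ (p + 1 - j) * (1 / y ^ j))) - 1 / d * (1 / y ^ Suc p)"
    unfolding step.IH by (simp add: ring_distribs sum_distrib_left)
  also have "(\<Sum>j=2..p. 1 / d * (1 / d ^ (p + 1 - j) * (1 / y ^ j))) =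
     (\<Sum>j=2..p. 1 / d ^ (Suc p + 1 - j) * (1 / y ^ j))"
    by (intro sum.cong) (auto simp: Suc_diff_le)
  also have "1 / d * (1 / d ^ (p - 1) * (1 / (y * z))) = 1 / d ^ (Suc p - 1) * (1 / (y * z))"
    using step.hyps by (cases p) auto
  finally show ?case
    using step.hyps by (simp add: atLeastAtMostSuc_conv)
qed

section \<open>Assembling the series\<close>

lemma harm_power_linear_sums:
  assumes p: "p \<ge> 1" and a: "a \<notin> \<int>\<^sub>\<le>\<^sub>0" and c: "c \<notin> \<int>\<^sub>\<le>\<^sub>0" and ne: "a \<noteq> c"
  shows "(\<lambda>n. harm (Suc n) / ((of_nat (Suc n) + a) ^ p * (of_nat (Suc n) + c))) sums
    (1 / (a - c) ^ (p - 1) *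
      (1 / (c - a) * (shifted_harm a / a - shifted_harm c / c)
      + (shifted_harm c ^ 2 - shifted_harm a ^ 2) / (2 * (c - a))
      + (hurwitz_zeta 2 (a + 1) - hurwitz_zeta 2 (c + 1)) / (2 * (c - a)))
     - (\<Sum>j=2..p. 1 / (a - c) ^ (p + 1 - j) *
          (\<Sum>n. harm (Suc n) / (of_nat (Suc n) + a) ^ j)))"
proof -
  have a1: "a + 1 \<notin> \<int>\<^sub>\<le>\<^sub>0" and c1: "c + 1 \<notin> \<int>\<^sub>\<le>\<^sub>0"
    using add_of_nat_notin_nonpos_Ints[of _ 1] a c by auto
  have eq: "harm (Suc n) / ((of_nat (Suc n) + a) ^ p * (of_nat (Suc n) + c)) =
      1 / (a - c) ^ (p - 1) * (harm (Suc n) / ((of_nat (Suc n) + a) * (of_nat (Suc n) + c))) -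
      (\<Sum>j=2..p. 1 / (a - c) ^ (p + 1 - j) * (harm (Suc n) / (of_nat (Suc n) + a) ^ j))" for n
  proof -
    have "harm (Suc n) / ((of_nat (Suc n) + a) ^ p * (of_nat (Suc n) + c)) =
      harm (Suc n) * (1 / ((of_nat (Suc n) + a) ^ p * (of_nat (Suc n) + c)))"
      by simp
    also note power_times_linear_partial_fraction[OF of_nat_Suc_add_neq_0[OF a1, of n]
        of_nat_Suc_add_neq_0[OF c1, of n] _ _ p, of "a - c"]
    finally show ?thesis
      using ne by (simp add: right_diff_distrib sum_distrib_left mult_ac del: of_nat_Suc)
  qed
  show ?thesis
    unfolding eq
    by (intro sums_diff sums_mult sums_sum harm_product_sums[OF a c ne] summable_sums
        summable_harm_over_shifted_power) auto
qed

theorem theorem4p1: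
  fixes p k :: nat and a b :: complex
  assumes "p \<ge> 1" and "k \<ge> 1"
    and "a \<notin> \<int>\<^sub>\<le>\<^sub>0" and "b \<notin> \<int>\<^sub>\<le>\<^sub>0"
    and "\<forall>r\<in>{1..k}. a \<noteq> b + of_nat r"
  shows "(\<forall>j\<in>{2..p}. summable (\<lambda>n. harm (Suc n) / (of_nat (Suc n) + a) ^ j)) \<and>
    (\<lambda>n. harm (Suc n) /
        ((of_nat (Suc n) + a) ^ p * ((of_nat (Suc n) + of_nat k + b) gchoose k)))
    sums
    ((\<Sum>r=1..k. (-1) ^ (r + 1) * of_nat r * of_nat (k choose r) *
        (1 / (a - b - of_nat r) ^ (p - 1)) *
        (1 / (b + of_nat r - a) *
           (shifted_harm a / a - shifted_harm (b + of_nat r) / (b + of_nat r))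
         + ((shifted_harm (b + of_nat r)) ^ 2 - (shifted_harm a) ^ 2) / (2 * (b + of_nat r - a))
         + (hurwitz_zeta 2 (a + 1) - hurwitz_zeta 2 (b + of_nat r + 1)) / (2 * (b + of_nat r - a))))
     - (\<Sum>r=1..k. (-1) ^ (r + 1) * of_nat r * of_nat (k choose r) *
        (\<Sum>j=2..p. 1 / (a - b - of_nat r) ^ (p + 1 - j) *
           (\<Sum>n. harm (Suc n) / (of_nat (Suc n) + a) ^ j))))"
proof (intro conjI ballI)
  show "summable (\<lambda>n. harm (Suc n) / (of_nat (Suc n) + a) ^ j)" if "j \<in> {2..p}" for j
    using that by (intro summable_harm_over_shifted_power) auto
next
  have b: "b + of_nat r \<notin> \<int>\<^sub>\<le>\<^sub>0" for r
    by (rule add_of_nat_notin_nonpos_Ints[OF assms(4)])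
  define w where "w r = ((-1) ^ (r + 1) * of_nat r * of_nat (k choose r) :: complex)" for r
  have "harm (Suc n) / ((of_nat (Suc n) + a) ^ p * ((of_nat (Suc n) + of_nat k + b) gchoose k)) =
      (\<Sum>r=1..k. w r * (harm (Suc n) / ((of_nat (Suc n) + a) ^ p * (of_nat (Suc n) + (b + of_nat r)))))"
    for n
  proof -
    have "of_nat (Suc n) + b + of_nat r \<noteq> 0" for r
      using of_nat_Suc_add_neq_0[OF add_of_nat_notin_nonpos_Ints[OF b[of r], of 1, simplified], of n]
      by (simp add: add_ac)
    from inverse_gbinomial_partial_fraction[OF assms(2), of "of_nat (Suc n) + b"] this
    have "1 / ((of_nat (Suc n) + of_nat k + b) gchoose k) =
       (\<Sum>r=1..k. w r / (of_nat (Suc n) + (b + of_nat r)))"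
      by (simp add: w_def add_ac del: of_nat_Suc)
    then have "harm (Suc n) / (of_nat (Suc n) + a) ^ p * (1 / ((of_nat (Suc n) + of_nat k + b) gchoose k)) =
       harm (Suc n) / (of_nat (Suc n) + a) ^ p * (\<Sum>r=1..k. w r / (of_nat (Suc n) + (b + of_nat r)))"
      by (rule arg_cong)
    then show ?thesis
      by (simp add: sum_distrib_left mult_ac del: of_nat_Suc)
  qed
  moreover have "a \<noteq> b + of_nat r" if "r \<in> {1..k}" for r
    using assms(5) that by blast
  then have "(\<lambda>n. \<Sum>r=1..k. w r *
      (harm (Suc n) / ((of_nat (Suc n) + a) ^ p * (of_nat (Suc n) + (b + of_nat r)))))
    sums (\<Sum>r=1..k. w r * (1 / (a - (b + of_nat r)) ^ (p - 1) *
      (1 / (b + of_nat r - a) *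
           (shifted_harm a / a - shifted_harm (b + of_nat r) / (b + of_nat r))
         + ((shifted_harm (b + of_nat r)) ^ 2 - (shifted_harm a) ^ 2) / (2 * (b + of_nat r - a))
         + (hurwitz_zeta 2 (a + 1) - hurwitz_zeta 2 (b + of_nat r + 1)) / (2 * (b + of_nat r - a)))
     - (\<Sum>j=2..p. 1 / (a - (b + of_nat r)) ^ (p + 1 - j) *
          (\<Sum>n. harm (Suc n) / (of_nat (Suc n) + a) ^ j))))"
    by (intro sums_sum sums_mult harm_power_linear_sums assms b) auto
  ultimately show "(\<lambda>n. harm (Suc n) /
        ((of_nat (Suc n) + a) ^ p * ((of_nat (Suc n) + of_nat k + b) gchoose k)))
    sums
    ((\<Sum>r=1..k. (-1) ^ (r + 1) * of_nat r * of_nat (k choose r) *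
        (1 / (a - b - of_nat r) ^ (p - 1)) *
        (1 / (b + of_nat r - a) *
           (shifted_harm a / a - shifted_harm (b + of_nat r) / (b + of_nat r))
         + ((shifted_harm (b + of_nat r)) ^ 2 - (shifted_harm a) ^ 2) / (2 * (b + of_nat r - a))
         + (hurwitz_zeta 2 (a + 1) - hurwitz_zeta 2 (b + of_nat r + 1)) / (2 * (b + of_nat r - a))))
     - (\<Sum>r=1..k. (-1) ^ (r + 1) * of_nat r * of_nat (k choose r) *
        (\<Sum>j=2..p. 1 / (a - b - of_nat r) ^ (p + 1 - j) *
           (\<Sum>n. harm (Suc n) / (of_nat (Suc n) + a) ^ j))))"
    unfolding w_def [symmetric]
    by (simp only: right_diff_distrib sum_subtractf mult.assoc diff_diff_eq)
qed

end
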